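(* Let $S$ be a profinite idempotent semiring, and let $X$ be a Boolean space. Then the continuous homomorphisms of $S$-semimodules \[ \delta\colon\mathbf{M}(X,S)\to\mathbf{C}(X,S^{\downarrow}),\ \mu\mapsto\delta_\mu,\qquad \int\colon\mathbf{C}(X,S^{\downarrow})\to\mathbf{M}(X,S),\ f\mapsto\Big(b\mapsto\int_b f\Big), \] where $\delta_\mu(x)=\bigwedge_{x\in b}\mu(b)$ (infimum over the clopens $b$ of $X$ containing $x$) and $\int_b f=\bigvee_{x\in b}f(x)$, are inverse to each other. Thus $\mathbf{M}(X,S)$, the algebra of all the $S$-valued measures on $X$, is isomorphic to the algebra $\mathbf{C}(X,S^{\downarrow})$ of all the continuous $S^{\downarrow}$-valued functions on $X$.
   Context: A Boolean space is a compact Hausdorff space admitting a basis of clopen sets. A semiring $S=(S,+,\cdot,0,1)$ consists of a commutative monoid $(S,+,0)$ and a monoid $(S,\cdot,1)$ such that $\cdot$ distributes over $+$ on both sides and $s\cdot 0=0=0\cdot s$. It is profinite if it is the limit of an inverse system of finite discrete semirings and semiring homomorphisms (equivalently, it carries a Boolean topology making $+$ and $\cdot$ continuous), and idempotent if $s+s=s$ for all $s$. An idempotent semiring is partially ordered by $s\leq t$ iff $s+u=t$ for some $u$; then $+$ is the binary join $\vee$ and $0$ is the least element. If $S$ is profinite and idempotent, then $S$ is a complete lattice in this order (known fact). $S^{\downarrow}$ denotes the set $S$ with the dual Scott topology: $U\subseteq S$ is open iff $U$ is downward closed and, for every codirected (i.e. down-directed) subset $D\subseteq S$, $\bigwedge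 D\in U$ implies $D\cap U\neq\emptyset$ (equivalently, $U$ is a downward closed set which is open in the profinite topology of $S$). Let $B$ be the Boolean algebra of clopen subsets of $X$. An $S$-valued measure on $X$ is a function $\mu\colon B\to S$ with $\mu(\emptyset)=0$ and $\mu(a\cup b)=\mu(a)\vee\mu(b)$ whenever $a\cap b=\emptyset$. $\mathbf{M}(X,S)$ is the set of all such measures with pointwise $S$-semimodule operations and the subspace topology of the product topology on $S^B$ ($S$ with its profinite topology). $\mathbf{C}(X,S^{\downarrow})$ is the set of all continuous functions $X\to S^{\downarrow}$, with pointwise $S$-semimodule operations (pointwise $\vee$ and $(s\cdot f)(x)=s\cdot f(x)$) and the topology generated by the sets $\{f\in\mathbf{C}(X,S^{\downarrow})\mid\int_b f\in U\}$ for $b\in B$ and $U$ open in $S$ (profinite topology). *)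

theory Defs
  imports "HOL-Analysis.Analysis"
begin

subsection \<open>Boolean spaces and profinite idempotent semirings\<close>

definition clopens :: "'x topology \<Rightarrow> 'x set set" where
  "clopens X = {b. openin X b \<and> closedin X b}"

definition boolean_space :: "'x topology \<Rightarrow> bool" where
  "boolean_space X \<longleftrightarrow> compact_space X \<and> Hausdorff_space X \<and>
     (\<exists>\<B>. \<B> \<subseteq> clopens X \<and> openin X = arbitrary union_of (\<lambda>b. b \<in> \<B>))"

text \<open>
  Semirings have the sort \<open>{semiring_0, monoid_mult}\<close>: multiplication need not commute, and, unlike
  in class \<open>semiring_1\<close>, the trivial semiring with \<open>0 = 1\<close> is allowed.

  Profinite semirings are taken in their intrinsic form: semirings with a Boolean topology for which
  addition and multiplication are continuous. These are the limits of inverse systems of finite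
  discrete semirings.
\<close>

class profinite_semiring =
  semiring_0 + monoid_mult + topological_comm_monoid_add + topological_monoid_mult +
  assumes boolean_space_UNIV: "boolean_space (topology (open :: 'a set \<Rightarrow> bool))"

text \<open>
  Class \<open>canonically_ordered_monoid_add\<close> fixes the order to be the one determined by addition:
  \<open>s \<le> t\<close> iff \<open>t = s + u\<close> for some \<open>u\<close>. In an idempotent semiring this relation is always a partial
  order, so the superclass imposes no condition; addition is the binary join.
\<close>

class idempotent_semiring = semiring_0 + monoid_mult + canonically_ordered_monoid_add +
  assumes add_idem: "s + s = s"

text \<open>
  Completeness of the order is a theorem for profinite idempotent semirings and is not built into
  the classes, so infima and suprema are introduced by description.
\<close>

definition glb :: "'s::order set \<Rightarrow> 's" where
  "glb A = (GREATEST l. \<forall>a\<in>A. l \<le> a)"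

definition lub :: "'s::order set \<Rightarrow> 's" where
  "lub A = (LEAST u. \<forall>a\<in>A. a \<le> u)"


subsection \<open>The dual Scott topology\<close>

definition codirected :: "'s::order set \<Rightarrow> bool" where
  "codirected D \<longleftrightarrow> D \<noteq> {} \<and> (\<forall>x\<in>D. \<forall>y\<in>D. \<exists>z\<in>D. z \<le> x \<and> z \<le> y)"

definition dual_scott_open :: "'s::order set \<Rightarrow> bool" where
  "dual_scott_open U \<longleftrightarrow>
     (\<forall>x\<in>U. \<forall>y. y \<le> x \<longrightarrow> y \<in> U) \<and>
     (\<forall>D. codirected D \<longrightarrow> glb D \<in> U \<longrightarrow> D \<inter> U \<noteq> {})"

definition dual_scott :: "'s::order topology" where
  "dual_scott = topology dual_scott_open"

lemma istopology_dual_scott_open: "istopology (dual_scott_open :: 's::order set \<Rightarrow> bool)"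
  unfolding istopology_def
proof (intro conjI allI impI)
  fix U V :: "'s set"
  assume U: "dual_scott_open U" and V: "dual_scott_open V"
  have down: "y \<in> U \<inter> V" if "x \<in> U \<inter> V" "y \<le> x" for x y
    using U V that unfolding dual_scott_open_def by (meson IntD1 IntD2 IntI)
  have "D \<inter> (U \<inter> V) \<noteq> {}" if D: "codirected D" and "glb D \<in> U \<inter> V" for D
  proof -
    have "D \<inter> U \<noteq> {}" "D \<inter> V \<noteq> {}"
      using U V that unfolding dual_scott_open_def by (meson IntD1 IntD2)+
    then obtain u v where uv: "u \<in> D" "u \<in> U" "v \<in> D" "v \<in> V"
      by blast
    then obtain z where z: "z \<in> D" "z \<le> u" "z \<le> v"
      using D unfolding codirected_def by meson
    have "z \<in> U" "z \<in> V"
      using U V uv z unfolding dual_scott_open_def by meson+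
    with z show ?thesis by blast
  qed
  with down show "dual_scott_open (U \<inter> V)"
    unfolding dual_scott_open_def by meson
next
  fix \<K> :: "'s set set"
  assume K: "\<forall>K\<in>\<K>. dual_scott_open K"
  have down: "y \<in> \<Union>\<K>" if "x \<in> \<Union>\<K>" "y \<le> x" for x y
    using K that unfolding dual_scott_open_def by (meson UnionE UnionI)
  have "D \<inter> \<Union>\<K> \<noteq> {}" if D: "codirected D" and glb: "glb D \<in> \<Union>\<K>" for D
  proof -
    obtain K where "K \<in> \<K>" "glb D \<in> K"
      using glb by blast
    moreover from this have "D \<inter> K \<noteq> {}"
      using K D unfolding dual_scott_open_def by meson
    ultimately show ?thesis by blast
  qed
  with down show "dual_scott_open (\<Union>\<K>)"
    unfolding dual_scott_open_def by meson
qed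

lemma openin_dual_scott: "openin dual_scott U \<longleftrightarrow> dual_scott_open U"
  unfolding dual_scott_def by (simp only: topology_inverse' [OF istopology_dual_scott_open])


subsection \<open>Semimodules with a topology\<close>

text \<open>The carrier of the semimodule is the underlying set of the topology.\<close>

record ('s, 'm) semimodule_top =
  mtop :: "'m topology"
  madd :: "'m \<Rightarrow> 'm \<Rightarrow> 'm"
  mzero :: "'m"
  msmult :: "'s \<Rightarrow> 'm \<Rightarrow> 'm"

abbreviation mcarrier :: "('s, 'm) semimodule_top \<Rightarrow> 'm set" where
  "mcarrier M \<equiv> topspace (mtop M)"

definition semimodule :: "('s::{semiring_0, monoid_mult}, 'm) semimodule_top \<Rightarrow> bool" where
  "semimodule M \<longleftrightarrow>
     mzero M \<in> mcarrier M \<and>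
     (\<forall>x\<in>mcarrier M. \<forall>y\<in>mcarrier M. madd M x y \<in> mcarrier M) \<and>
     (\<forall>s. \<forall>x\<in>mcarrier M. msmult M s x \<in> mcarrier M) \<and>
     (\<forall>x\<in>mcarrier M. \<forall>y\<in>mcarrier M. \<forall>z\<in>mcarrier M.
        madd M (madd M x y) z = madd M x (madd M y z)) \<and>
     (\<forall>x\<in>mcarrier M. \<forall>y\<in>mcarrier M. madd M x y = madd M y x) \<and>
     (\<forall>x\<in>mcarrier M. madd M (mzero M) x = x) \<and>
     (\<forall>s. \<forall>x\<in>mcarrier M. \<forall>y\<in>mcarrier M.
        msmult M s (madd M x y) = madd M (msmult M s x) (msmult M s y)) \<and>
     (\<forall>s t. \<forall>x\<in>mcarrier M. msmult M (s + t) x = madd M (msmult M s x) (msmult M t x)) \<and>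
     (\<forall>s t. \<forall>x\<in>mcarrier M. msmult M (s * t) x = msmult M s (msmult M t x)) \<and>
     (\<forall>x\<in>mcarrier M. msmult M 1 x = x) \<and>
     (\<forall>x\<in>mcarrier M. msmult M 0 x = mzero M) \<and>
     (\<forall>s. msmult M s (mzero M) = mzero M)"

definition continuous_semimodule_hom ::
  "('s::{semiring_0, monoid_mult}, 'm) semimodule_top \<Rightarrow> ('s, 'n) semimodule_top \<Rightarrow> ('m \<Rightarrow> 'n) \<Rightarrow> bool"
  where
  "continuous_semimodule_hom M N h \<longleftrightarrow>
     semimodule M \<and> semimodule N \<and>
     continuous_map (mtop M) (mtop N) h \<and>
     h (mzero M) = mzero N \<and>
     (\<forall>x\<in>mcarrier M. \<forall>y\<in>mcarrier M. h (madd M x y) = madd N (h x) (h y)) \<and>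
     (\<forall>s. \<forall>x\<in>mcarrier M. h (msmult M s x) = msmult N s (h x))"

definition isomorphic_semimodules ::
  "('s::{semiring_0, monoid_mult}, 'm) semimodule_top \<Rightarrow> ('s, 'n) semimodule_top \<Rightarrow> bool" where
  "isomorphic_semimodules M N \<longleftrightarrow>
     (\<exists>h k. continuous_semimodule_hom M N h \<and> continuous_semimodule_hom N M k \<and>
        (\<forall>x\<in>mcarrier M. k (h x) = x) \<and> (\<forall>y\<in>mcarrier N. h (k y) = y))"


subsection \<open>Measures\<close>

text \<open>
  Functions on the clopens of \<open>X\<close>, and functions on the points of \<open>X\<close>, are represented by extensional
  HOL functions, as in \<^const>\<open>product_topology\<close>.
\<close>

definition S_measures :: "'x topology \<Rightarrow> ('x set \<Rightarrow> 's::idempotent_semiring) set" where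
  "S_measures X = {\<mu> \<in> extensional (clopens X).
     \<mu> {} = 0 \<and>
     (\<forall>a\<in>clopens X. \<forall>b\<in>clopens X. a \<inter> b = {} \<longrightarrow> \<mu> (a \<union> b) = \<mu> a + \<mu> b)}"

definition measure_semimodule ::
  "'x topology \<Rightarrow> ('s::{idempotent_semiring, profinite_semiring}, 'x set \<Rightarrow> 's) semimodule_top" where
  "measure_semimodule X =
     \<lparr>mtop = subtopology (product_topology (\<lambda>_. euclidean) (clopens X)) (S_measures X),
      madd = (\<lambda>\<mu> \<nu>. \<lambda>b\<in>clopens X. \<mu> b + \<nu> b),
      mzero = (\<lambda>b\<in>clopens X. 0),
      msmult = (\<lambda>s \<mu>. \<lambda>b\<in>clopens X. s * \<mu> b)\<rparr>"


subsection \<open>Continuous functions into the dual Scott topology\<close>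

definition continuous_functions :: "'x topology \<Rightarrow> ('x \<Rightarrow> 's::idempotent_semiring) set" where
  "continuous_functions X = {f \<in> extensional (topspace X). continuous_map X dual_scott f}"

definition integral_over :: "'x set \<Rightarrow> ('x \<Rightarrow> 's::idempotent_semiring) \<Rightarrow> 's" where
  "integral_over b f = lub (f ` b)"

definition function_semimodule ::
  "'x topology \<Rightarrow> ('s::{idempotent_semiring, profinite_semiring}, 'x \<Rightarrow> 's) semimodule_top" where
  "function_semimodule X =
     \<lparr>mtop = topology_generated_by
        {{f \<in> continuous_functions X. integral_over b f \<in> U} | b U. b \<in> clopens X \<and> open U},
      madd = (\<lambda>f g. \<lambda>x\<in>topspace X. f x + g x),
      mzero = (\<lambda>x\<in>topspace X. 0),
      msmult = (\<lambda>s f. \<lambda>x\<in>topspace X. s * f x)\<rparr>"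

lemma mcarrier_measure_semimodule: "mcarrier (measure_semimodule X) = S_measures X"
  unfolding measure_semimodule_def by (auto simp: PiE_UNIV_domain S_measures_def extensional_def PiE_iff)

lemma mcarrier_function_semimodule: "mcarrier (function_semimodule X) = continuous_functions X"
proof -
  have "{} \<in> clopens X" by (simp add: clopens_def)
  then show ?thesis
    by (auto simp: function_semimodule_def intro: open_UNIV)
qed


subsection \<open>The two maps\<close>

definition delta :: "'x topology \<Rightarrow> ('x set \<Rightarrow> 's::idempotent_semiring) \<Rightarrow> 'x \<Rightarrow> 's" where
  "delta X \<mu> = (\<lambda>x\<in>topspace X. glb (\<mu> ` {b \<in> clopens X. x \<in> b}))"

definition integral_measure ::
  "'x topology \<Rightarrow> ('x \<Rightarrow> 's::idempotent_semiring) \<Rightarrow> 'x set \<Rightarrow> 's" where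
  "integral_measure X f = (\<lambda>b\<in>clopens X. integral_over b f)"

end

theory Submission
  imports Defs
begin

text \<open>
  Call \<open>k\<close> cocompact if its principal ideal \<open>{..k}\<close> is open, hence clopen. Zero-dimensionality and
  continuity of the join imply that every \<open>s\<close> is the codirected infimum of the cocompact elements
  above it (dually: a compact zero-dimensional semilattice is an algebraic lattice with its Lawson
  topology). Hence the principal ideals of cocompact elements form a base of the dual Scott topology,
  and every inequality between elements of \<open>S\<close> can be tested against cocompact upper bounds. If
  \<open>k\<close> is such a bound, then \<open>f x \<le> k\<close> spreads to a clopen neighbourhood of \<open>x\<close> when \<open>f\<close> is continuous,
  and \<open>delta X \<mu> x \<le> k\<close> means that \<open>\<mu> b \<le> k\<close> for some clopen \<open>b\<close> containing \<open>x\<close>. Hence integrating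
  a continuous function and taking the density recovers it, and compactness of \<open>X\<close> glues finitely
  many such \<open>b\<close> to recover a measure from its density.
\<close>

section \<open>Compactness and order in profinite idempotent semirings\<close>

text \<open>Transfers the Hausdorff property to the type class, so that equalizers of continuous
  maps and compact sets are known to be closed.\<close>

instance profinite_semiring \<subseteq> t2_space
proof
  fix x y :: 'a
  assume "x \<noteq> y"
  have "Hausdorff_space (euclidean :: 'a topology)"
    using boolean_space_UNIV unfolding boolean_space_def by blast
  then show "\<exists>U V. open U \<and> open V \<and> x \<in> U \<and> y \<in> V \<and> U \<inter> V = {}"
    using \<open>x \<noteq> y\<close> unfolding Hausdorff_space_def disjnt_def by auto
qed

lemma compact_UNIV_profinite: "compact (UNIV :: 's::profinite_semiring set)"
proof -
  have "compact_space (euclidean :: 's topology)"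
    using boolean_space_UNIV unfolding boolean_space_def by blast
  then show ?thesis by (simp add: compact_space_def)
qed

lemma boolean_space_clopen_nbhd:
  assumes "boolean_space X" "openin X V" "x \<in> V"
  obtains b where "b \<in> clopens X" "x \<in> b" "b \<subseteq> V"
proof -
  obtain \<B> where "\<B> \<subseteq> clopens X" "openin X = arbitrary union_of (\<lambda>b. b \<in> \<B>)"
    using assms(1) unfolding boolean_space_def by blast
  then obtain \<U> where "\<U> \<subseteq> clopens X" "\<Union>\<U> = V"
    using assms(2) unfolding union_of_def by auto
  then show thesis
    using assms(3) that by blast
qed

lemma clopen_separation:
  fixes s t :: "'s::profinite_semiring"
  assumes "s \<noteq> t"
  obtains U where "open U" "closed U" "s \<in> U" "t \<notin> U"
proof -
  have "openin (euclidean :: 's topology) (- {t})" "s \<in> - {t}"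
    using assms by auto
  then obtain b where "b \<in> clopens (euclidean :: 's topology)" "s \<in> b" "b \<subseteq> - {t}"
    by (rule boolean_space_clopen_nbhd[OF boolean_space_UNIV])
  then show thesis
    using that unfolding clopens_def by auto
qed

section \<open>Addition as binary join\<close>

lemma le_add_left:
  fixes s t :: "'s::idempotent_semiring"
  shows "s \<le> s + t" "t \<le> s + t"
  by (metis le_iff_add) (metis add.commute le_iff_add)

lemma le_iff_add_eq:
  fixes s t :: "'s::idempotent_semiring"
  shows "s \<le> t \<longleftrightarrow> s + t = t"
proof
  assume "s \<le> t"
  then obtain u where "t = s + u" by (auto simp: le_iff_add)
  then show "s + t = t" by (simp add: add.assoc[symmetric] add_idem)
next
  assume "s + t = t"
  then show "s \<le> t" using le_add_left(1)[of s t] by simp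
qed

lemma add_le_iff:
  fixes s t u :: "'s::idempotent_semiring"
  shows "s + t \<le> u \<longleftrightarrow> s \<le> u \<and> t \<le> u"
proof
  assume "s + t \<le> u"
  then show "s \<le> u \<and> t \<le> u"
    using order_trans[OF le_add_left(1)] order_trans[OF le_add_left(2)] by blast
next
  assume "s \<le> u \<and> t \<le> u"
  then show "s + t \<le> u" by (simp add: le_iff_add_eq add.assoc)
qed

text \<open>Equalizers of continuous maps into a Hausdorff space. In the idempotent case these sets
  are the principal filter and the principal ideal of \<open>u\<close>.\<close>

lemma closed_Collect_add_eq:
  fixes u v :: "'s::profinite_semiring"
  shows "closed {t. t + u = t}" "closed {t. t + u = u}"
proof -
  have "continuous_on UNIV (\<lambda>t. t + u)" by (intro continuous_intros)
  then show "closed {t. t + u = t}" "closed {t. t + u = u}"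
    by (auto intro!: closed_Collect_eq)
qed

lemma closed_atMost_profinite: "closed {..u :: 's::{idempotent_semiring, profinite_semiring}}"
  using closed_Collect_add_eq(2)[of u] by (simp add: atMost_def le_iff_add_eq)

lemma closed_atLeast_profinite: "closed {u :: 's::{idempotent_semiring, profinite_semiring}..}"
  using closed_Collect_add_eq(1)[of u] by (simp add: atLeast_def le_iff_add_eq add.commute)

text \<open>Finite joins show that the closed sets \<open>C \<inter> {c..}\<close> have the finite
  intersection property. By compactness they share a point, which is the greatest element of
  \<open>C\<close>.\<close>

lemma closed_add_closed_has_greatest:
  fixes C :: "'s::{idempotent_semiring, profinite_semiring} set"
  assumes "closed C" "C \<noteq> {}" and add: "\<And>s t. s \<in> C \<Longrightarrow> t \<in> C \<Longrightarrow> s + t \<in> C"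
  obtains m where "m \<in> C" "\<And>c. c \<in> C \<Longrightarrow> c \<le> m"
proof -
  have "UNIV \<inter> (\<Inter>c\<in>C. C \<inter> {c..}) \<noteq> {}"
  proof (rule compact_imp_fip_image[OF compact_UNIV_profinite])
    show "closed (C \<inter> {c..})" for c
      using assms(1) closed_atLeast_profinite by blast
    fix F assume "finite F" "F \<subseteq> C"
    then have "\<exists>m\<in>C. \<forall>c\<in>F. c \<le> m"
    proof (induction F rule: finite_induct)
      case empty
      then show ?case using assms(2) by auto
    next
      case (insert a F)
      then obtain m where "m \<in> C" "\<forall>c\<in>F. c \<le> m" "a \<in> C" by auto
      then show ?case
        using add by (intro bexI[of _ "a + m"]) (auto intro: le_add_left order_trans[OF _ le_add_left(2)])
    qed
    then show "UNIV \<inter> (\<Inter>c\<in>F. C \<inter> {c..}) \<noteq> {}"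
      by auto
  qed
  then show thesis
    using that assms(2) by auto
qed

section \<open>Suprema and infima: completeness of the lattice\<close>

lemma lub_eqI:
  assumes "\<And>a. a \<in> A \<Longrightarrow> a \<le> m" "\<And>u. (\<And>a. a \<in> A \<Longrightarrow> a \<le> u) \<Longrightarrow> m \<le> u"
  shows "lub A = m"
  unfolding lub_def using assms by (intro Least_equality) auto

lemma glb_eqI:
  assumes "\<And>a. a \<in> A \<Longrightarrow> m \<le> a" "\<And>l. (\<And>a. a \<in> A \<Longrightarrow> l \<le> a) \<Longrightarrow> l \<le> m"
  shows "glb A = m"
  unfolding glb_def using assms by (intro Greatest_equality) auto

text \<open>The members of \<open>C\<close> below every upper bound of \<open>A\<close> form a
  closed subsemilattice that contains \<open>A\<close> and \<open>0\<close>; its greatest element is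
  the supremum. Taking \<open>C = UNIV\<close> gives completeness, while smaller \<open>C\<close>
  carry properties from \<open>A\<close> over to \<open>lub A\<close>.\<close>

lemma lub_in_closed:
  fixes A C :: "'s::{idempotent_semiring, profinite_semiring} set"
  assumes "closed C" "0 \<in> C" "\<And>s t. s \<in> C \<Longrightarrow> t \<in> C \<Longrightarrow> s + t \<in> C" "A \<subseteq> C"
  shows "lub A \<in> C" and "a \<in> A \<Longrightarrow> a \<le> lub A" and "(\<And>a. a \<in> A \<Longrightarrow> a \<le> u) \<Longrightarrow> lub A \<le> u"
proof -
  define I where "I = C \<inter> (\<Inter>u\<in>{u. \<forall>a\<in>A. a \<le> u}. {..u})"
  have "closed I"
    unfolding I_def using assms(1) closed_atMost_profinite by blast
  moreover have "I \<noteq> {}"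
    using assms(2) by (auto simp: I_def)
  moreover have "s + t \<in> I" if "s \<in> I" "t \<in> I" for s t
    using that assms(3) by (auto simp: I_def add_le_iff)
  ultimately obtain m where m: "m \<in> I" "\<And>c. c \<in> I \<Longrightarrow> c \<le> m"
    using closed_add_closed_has_greatest by blast
  have ub: "a \<le> m" if "a \<in> A" for a
    using that assms(4) by (intro m(2)) (auto simp: I_def)
  have least: "m \<le> u" if "\<And>a. a \<in> A \<Longrightarrow> a \<le> u" for u
    using that m(1) by (auto simp: I_def)
  have "lub A = m"
    using ub least by (rule lub_eqI)
  then show "lub A \<in> C" "a \<in> A \<Longrightarrow> a \<le> lub A" "(\<And>a. a \<in> A \<Longrightarrow> a \<le> u) \<Longrightarrow> lub A \<le> u"
    using m(1) ub least by (auto simp: I_def)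
qed

lemma lub_upper:
  fixes A :: "'s::{idempotent_semiring, profinite_semiring} set"
  shows "a \<in> A \<Longrightarrow> a \<le> lub A"
  using lub_in_closed(2)[of UNIV A a] by auto

lemma lub_le_iff:
  fixes A :: "'s::{idempotent_semiring, profinite_semiring} set"
  shows "lub A \<le> u \<longleftrightarrow> (\<forall>a\<in>A. a \<le> u)"
  using lub_in_closed(3)[of UNIV A u] order_trans[OF lub_upper] by auto

lemma le_glb_iff:
  fixes A :: "'s::{idempotent_semiring, profinite_semiring} set"
  shows "l \<le> glb A \<longleftrightarrow> (\<forall>a\<in>A. l \<le> a)"
proof -
  \<comment> \<open>The infimum is obtained as the supremum of all lower bounds.\<close>
  define m where "m = lub {l. \<forall>a\<in>A. l \<le> a}"
  have lower: "m \<le> a" if "a \<in> A" for a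
    unfolding m_def using that by (auto simp: lub_le_iff)
  have "l \<le> m" if "\<And>a. a \<in> A \<Longrightarrow> l \<le> a" for l
    unfolding m_def using that by (intro lub_upper) auto
  with lower have "glb A = m"
    by (rule glb_eqI)
  with lower show ?thesis
    using \<open>\<And>l. (\<And>a. a \<in> A \<Longrightarrow> l \<le> a) \<Longrightarrow> l \<le> m\<close> order_trans by blast
qed

lemma glb_lower:
  fixes A :: "'s::{idempotent_semiring, profinite_semiring} set"
  shows "a \<in> A \<Longrightarrow> glb A \<le> a"
  using le_glb_iff by blast

section \<open>Multiplication and suprema\<close>

lemma mult_left_mono_idem:
  fixes s t u :: "'s::idempotent_semiring"
  shows "t \<le> u \<Longrightarrow> s * t \<le> s * u"
  by (metis distrib_left le_iff_add)

lemma closed_mult_le: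
  fixes s u :: "'s::{idempotent_semiring, profinite_semiring}"
  shows "closed {t. s * t \<le> u}"
proof -
  have "continuous_on UNIV (\<lambda>t. s * t)"
    by (intro continuous_intros)
  then show ?thesis
    using closed_vimage[OF closed_atMost_profinite[of u]] by (simp add: vimage_def)
qed

lemma lub_mult_left:
  fixes s :: "'s::{idempotent_semiring, profinite_semiring}"
  shows "lub ((\<lambda>a. s * a) ` A) = s * lub A"
proof (rule lub_eqI)
  show "a \<le> s * lub A" if "a \<in> (\<lambda>a. s * a) ` A" for a
    using that by (auto intro: mult_left_mono_idem lub_upper)
  fix u assume u: "\<And>a. a \<in> (\<lambda>a. s * a) ` A \<Longrightarrow> a \<le> u"
  \<comment> \<open>This set is closed, contains \<open>0\<close> and is stable under joins by
    distributivity, so it contains the supremum of each of its subsets.\<close>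
  have "lub A \<in> {t. s * t \<le> u}"
    using u by (intro lub_in_closed(1) closed_mult_le) (auto simp: distrib_left add_le_iff)
  then show "s * lub A \<le> u" by simp
qed

section \<open>Codirected infima as topological limits\<close>

lemma codirected_finite_lower_bound:
  assumes "codirected D" "finite F" "F \<subseteq> D"
  obtains d where "d \<in> D" "\<And>x. x \<in> F \<Longrightarrow> d \<le> x"
proof -
  from assms(2,3) have "\<exists>d\<in>D. \<forall>x\<in>F. d \<le> x"
  proof (induction F rule: finite_induct)
    case empty
    then show ?case using assms(1) by (auto simp: codirected_def)
  next
    case (insert a F)
    then obtain d where "d \<in> D" "\<forall>x\<in>F. d \<le> x" "a \<in> D" by auto
    moreover obtain z where "z \<in> D" "z \<le> a" "z \<le> d"
      using assms(1) \<open>d \<in> D\<close> \<open>a \<in> D\<close> unfolding codirected_def by blast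
    ultimately show ?case
      using order_trans[OF \<open>z \<le> d\<close>] by (intro bexI[of _ z]) auto
  qed
  then show thesis using that by blast
qed

text \<open>Compactness provides a lower bound \<open>m\<close> of \<open>D\<close> inside the
  closure of \<open>D\<close>. The closure stays above \<open>glb D\<close>, so \<open>m\<close> can
  only be \<open>glb D\<close>.\<close>

lemma glb_codirected_in_closure:
  fixes D :: "'s::{idempotent_semiring, profinite_semiring} set"
  assumes "codirected D"
  shows "glb D \<in> closure D"
proof -
  have "UNIV \<inter> (\<Inter>d\<in>D. closure D \<inter> {..d} ) \<noteq> {}"
  proof (rule compact_imp_fip_image[OF compact_UNIV_profinite])
    show "closed (closure D \<inter> {..d})" for d
      using closed_atMost_profinite by blast
    fix F assume "finite F" "F \<subseteq> D"
    then obtain d where "d \<in> D" "\<And>x. x \<in> F \<Longrightarrow> d \<le> x"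
      using codirected_finite_lower_bound[OF assms] by blast
    then have "d \<in> UNIV \<inter> (\<Inter>x\<in>F. closure D \<inter> {..x})"
      using closure_subset[of D] by auto
    then show "UNIV \<inter> (\<Inter>d\<in>F. closure D \<inter> {..d}) \<noteq> {}"
      by blast
  qed
  then obtain m where m: "m \<in> closure D" "\<And>d. d \<in> D \<Longrightarrow> m \<le> d"
    using assms by (auto simp: codirected_def)
  have "closure D \<subseteq> {glb D..}"
    using closed_atLeast_profinite glb_lower by (intro closure_minimal) auto
  then have "glb D = m"
    using m by (intro order_antisym) (auto simp: le_glb_iff)
  with m show ?thesis by simp
qed


section \<open>Cocompact elements\<close>

text \<open>A topological form of compactness in the dual order;
  \<open>codirected_glb_le_cocompact\<close> derives the order-theoretic property from it.\<close>

definition cocompact :: "'s::{idempotent_semiring, profinite_semiring} \<Rightarrow> bool" where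
  "cocompact k \<longleftrightarrow> open {..k}"

text \<open>Source of cocompact elements: a clopen ideal is closed under joins, so it has a greatest
  element and is principal.\<close>

lemma cocompact_of_clopen_ideal:
  fixes J :: "'s::{idempotent_semiring, profinite_semiring} set"
  assumes "open J" "closed J" "0 \<in> J"
    and "\<And>s t. s \<in> J \<Longrightarrow> t \<in> J \<Longrightarrow> s + t \<in> J" and "\<And>s t. s \<in> J \<Longrightarrow> t \<le> s \<Longrightarrow> t \<in> J"
  obtains k where "cocompact k" "J = {..k}"
proof -
  obtain m where "m \<in> J" "\<And>c. c \<in> J \<Longrightarrow> c \<le> m"
    using closed_add_closed_has_greatest[of J] assms by blast
  then have "J = {..m}"
    using assms(5) by auto
  with assms(1) that show thesis
    by (auto simp: cocompact_def)
qed

text \<open>The intersection of two clopen principal ideals is a clopen ideal; its generator is the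
  binary meet.\<close>

lemma cocompact_inf:
  fixes k l :: "'s::{idempotent_semiring, profinite_semiring}"
  assumes "cocompact k" "cocompact l"
  obtains m where "cocompact m" "\<And>s. s \<le> m \<longleftrightarrow> s \<le> k \<and> s \<le> l"
proof -
  obtain m where "cocompact m" "{..k} \<inter> {..l} = {..m}"
    using assms
    by (elim cocompact_of_clopen_ideal[of "{..k} \<inter> {..l}", rotated -1])
       (auto simp: cocompact_def add_le_iff closed_atMost_profinite dest: order_trans)
  then show thesis using that by (auto simp: set_eq_iff)
qed

text \<open>Left multiplication by \<open>s\<close> is continuous and preserves finite joins, so the
  preimage of a clopen ideal is again a clopen ideal. Its generator, the residual of
  \<open>k\<close> by \<open>s\<close>, turns bounds on multiples into bounds on the factor.\<close>

lemma cocompact_mult_residual: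
  fixes k s :: "'s::{idempotent_semiring, profinite_semiring}"
  assumes "cocompact k"
  obtains m where "cocompact m" "\<And>t. s * t \<le> k \<longleftrightarrow> t \<le> m"
proof -
  have "continuous_on UNIV (\<lambda>t. s * t)"
    by (intro continuous_intros)
  then have "open {t. s * t \<le> k}"
    using open_vimage[of "{..k}" "\<lambda>t. s * t"] assms by (simp add: vimage_def cocompact_def)
  then obtain m where "cocompact m" "{t. s * t \<le> k} = {..m}"
    by (elim cocompact_of_clopen_ideal[of "{t. s * t \<le> k}", rotated -1])
       (auto simp: closed_mult_le distrib_left add_le_iff intro: order_trans[OF mult_left_mono_idem])
  then show thesis using that by (auto simp: set_eq_iff)
qed

text \<open>
  The class \<open>C\<close> of \<open>s\<close> under the syntactic congruence of a clopen set separating \<open>s\<close> from \<open>s + l\<close> is a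
  clopen subsemilattice, and its greatest element is the required one.
\<close>

lemma cocompact_separation:
  fixes s l :: "'s::{idempotent_semiring, profinite_semiring}"
  assumes "\<not> l \<le> s"
  obtains k where "cocompact k" "s \<le> k" "\<not> l \<le> k"
proof -
  have "s \<noteq> s + l"
    using assms le_add_left(2) by metis
  then obtain U where U: "open U" "closed U" "s \<in> U" "s + l \<notin> U"
    using clopen_separation by blast
  define C where "C = {t. \<forall>u. t + u \<in> U \<longleftrightarrow> s + u \<in> U}"
  \<comment> \<open>\<open>P\<close> collects the pairs \<open>(t, u)\<close> in which
    \<open>u\<close> witnesses that \<open>t\<close> is not in \<open>C\<close>. It is compact, so
    its projection, the complement of \<open>C\<close>, is closed. This is how \<open>C\<close>
    becomes open despite the quantifier over all \<open>u\<close>.\<close>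
  define P where "P = {p :: 's \<times> 's. (fst p + snd p \<in> U) \<noteq> (s + snd p \<in> U)}"
  \<comment> \<open>The domain is polymorphic: the fact serves maps on pairs for \<open>P\<close>
    and maps on \<open>'s\<close> for \<open>C\<close>.\<close>
  have clopen_pre: "open (h -` U)" "closed (h -` U)" if "continuous_on UNIV h" for h :: "'b::topological_space \<Rightarrow> 's"
    using that U open_vimage closed_vimage by blast+
  have P_eq: "P = ((\<lambda>p. fst p + snd p) -` U \<inter> - ((\<lambda>p. s + snd p) -` U)) \<union>
                  (- ((\<lambda>p. fst p + snd p) -` U) \<inter> (\<lambda>p. s + snd p) -` U)"
    unfolding P_def by auto
  have "closed P"
    unfolding P_eq
    by (intro closed_Un closed_Int closed_Compl clopen_pre continuous_intros)
  moreover have "compact (UNIV :: ('s \<times> 's) set)"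
    using compact_Times[OF compact_UNIV_profinite compact_UNIV_profinite] by simp
  ultimately have "compact P"
    using compact_Int_closed by fastforce
  then have "closed (fst ` P)"
    by (intro compact_imp_closed compact_continuous_image continuous_intros)
  moreover have "C = - (fst ` P)"
    unfolding C_def P_def by (force simp: image_iff)
  ultimately have "open C" by (simp only: open_Compl)
  have "C = (\<Inter>u. if s + u \<in> U then (\<lambda>t. t + u) -` U else - ((\<lambda>t. t + u) -` U))"
    unfolding C_def by auto
  also have "closed \<dots>"
    by (auto intro!: closed_INT closed_Compl clopen_pre continuous_intros)
  finally have "closed C" .
  have "s \<in> C" by (simp add: C_def)
  \<comment> \<open>Replacing \<open>t\<close> and then \<open>t'\<close> by \<open>s\<close> under
    the congruence leads to \<open>s + s\<close>, which is \<open>s\<close>.\<close>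
  have add: "t + t' \<in> C" if "t \<in> C" "t' \<in> C" for t t'
  proof -
    have "t + t' + u \<in> U \<longleftrightarrow> s + u \<in> U" for u
    proof -
      have "t + (t' + u) \<in> U \<longleftrightarrow> s + (t' + u) \<in> U"
        using that(1) by (simp add: C_def)
      then have "t + t' + u \<in> U \<longleftrightarrow> t' + (s + u) \<in> U"
        by (simp add: add.assoc add.left_commute[of t'])
      also have "\<dots> \<longleftrightarrow> s + (s + u) \<in> U"
        using that(2) by (simp add: C_def)
      finally show ?thesis
        by (simp add: add.assoc[symmetric] add_idem)
    qed
    then show ?thesis by (simp add: C_def)
  qed
  obtain k where k: "k \<in> C" "\<And>c. c \<in> C \<Longrightarrow> c \<le> k"
    using closed_add_closed_has_greatest[OF \<open>closed C\<close> _ add] \<open>s \<in> C\<close> by blast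
  \<comment> \<open>\<open>C\<close> need not be downward closed, but \<open>t + k\<close> lies in
    \<open>C\<close> exactly when \<open>k\<close> absorbs \<open>t\<close>, because
    \<open>k\<close> is the greatest element of \<open>C\<close>.\<close>
  have "{..k} = (\<lambda>t. t + k) -` C"
  proof (intro set_eqI iffI)
    show "t \<in> (\<lambda>t. t + k) -` C" if "t \<in> {..k}" for t
      using that k(1) by (simp add: le_iff_add_eq)
    show "t \<in> {..k}" if "t \<in> (\<lambda>t. t + k) -` C" for t
      using that k(2)[of "t + k"] by (simp add: add_le_iff)
  qed
  moreover have "open ((\<lambda>t. t + k) -` C)"
    using \<open>open C\<close> by (intro open_vimage continuous_intros)
  ultimately have "cocompact k" by (simp add: cocompact_def)
  moreover have "\<not> l \<le> k"
  proof
    assume "l \<le> k"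
    then have "k + l = k" by (simp add: le_iff_add_eq add.commute)
    \<comment> \<open>The congruence of \<open>k\<close> and \<open>s\<close> is tested at
      \<open>u = 0\<close> and at \<open>u = l\<close>.\<close>
    moreover have "k \<in> U" "k + l \<notin> U"
      using k(1) U(3,4) spec[of "\<lambda>u. k + u \<in> U \<longleftrightarrow> s + u \<in> U" 0] by (auto simp: C_def)
    ultimately show False by simp
  qed
  ultimately show thesis
    using that k(2) \<open>s \<in> C\<close> by blast
qed

text \<open>Contrapositive of the separation lemma; the later inequalities are reduced to cocompact
  bounds through it.\<close>

lemma le_if_le_cocompact:
  fixes s l :: "'s::{idempotent_semiring, profinite_semiring}"
  assumes "\<And>k. cocompact k \<Longrightarrow> s \<le> k \<Longrightarrow> l \<le> k"
  shows "l \<le> s"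
  using assms cocompact_separation by blast

text \<open>The infimum lies in the closure of \<open>D\<close>, so its open neighbourhood
  \<open>{..k}\<close> meets \<open>D\<close>.\<close>

lemma codirected_glb_le_cocompact:
  fixes D :: "'s::{idempotent_semiring, profinite_semiring} set"
  assumes "codirected D" "cocompact k" "glb D \<le> k"
  obtains d where "d \<in> D" "d \<le> k"
proof -
  have "D \<inter> {..k} \<noteq> {}"
    using glb_codirected_in_closure[OF assms(1)] assms(2,3) open_Int_closure_eq_empty[of "{..k}" D]
    by (auto simp: cocompact_def)
  then show thesis using that by auto
qed

section \<open>The dual Scott topology through cocompact elements\<close>

lemma dual_scott_open_cocompact: "cocompact k \<Longrightarrow> dual_scott_open {..k}"
  unfolding dual_scott_open_def
proof (intro conjI allI impI ballI)
  show "y \<in> {..k}" if "x \<in> {..k}" "y \<le> x" for x y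
    using that by (auto dest: order_trans)
  show "D \<inter> {..k} \<noteq> {}" if "cocompact k" "codirected D" "glb D \<in> {..k}" for D
    using codirected_glb_le_cocompact[of D k] that by auto
qed

text \<open>The cocompact elements above \<open>s\<close> are codirected with infimum
  \<open>s\<close>, so one of them already lies in \<open>U\<close>, together with its principal
  ideal.\<close>

lemma dual_scott_open_cocompact_nbhd:
  fixes s :: "'s::{idempotent_semiring, profinite_semiring}"
  assumes "dual_scott_open U" "s \<in> U"
  obtains k where "cocompact k" "s \<le> k" "{..k} \<subseteq> U"
proof -
  let ?D = "{k. cocompact k \<and> s \<le> k}"
  \<comment> \<open>The top element, whose ideal is the whole space, makes \<open>?D\<close>
    nonempty.\<close>
  have "cocompact (lub (UNIV :: 's set))"
  proof -
    have "{..lub (UNIV :: 's set)} = UNIV" by (auto intro: lub_upper)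
    then show ?thesis by (simp add: cocompact_def)
  qed
  then have "codirected ?D"
    unfolding codirected_def
  proof (intro conjI ballI)
    show "?D \<noteq> {}"
      using \<open>cocompact (lub UNIV)\<close> lub_upper by blast
    fix k l assume kl: "k \<in> ?D" "l \<in> ?D"
    then obtain m where m: "cocompact m" "\<And>s. s \<le> m \<longleftrightarrow> s \<le> k \<and> s \<le> l"
      using cocompact_inf[of k l] by auto
    then have "m \<in> ?D" "m \<le> k" "m \<le> l"
      using kl order_refl[of m] by auto
    then show "\<exists>z\<in>?D. z \<le> k \<and> z \<le> l" by blast
  qed
  moreover have "glb ?D = s"
    by (rule glb_eqI) (auto intro: le_if_le_cocompact)
  ultimately have "?D \<inter> U \<noteq> {}"
    using assms unfolding dual_scott_open_def by simp
  then obtain k where k: "cocompact k" "s \<le> k" "k \<in> U"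
    by blast
  moreover have "{..k} \<subseteq> U"
    using assms(1) k(3) unfolding dual_scott_open_def by auto
  ultimately show thesis using that by simp
qed

text \<open>Principal ideals of cocompact elements form a base, so continuity amounts to openness of
  the corresponding sublevel sets.\<close>

lemma continuous_map_dual_scott_iff:
  fixes f :: "'x \<Rightarrow> 's::{idempotent_semiring, profinite_semiring}"
  shows "continuous_map X dual_scott f \<longleftrightarrow>
    (\<forall>k. cocompact k \<longrightarrow> openin X {x \<in> topspace X. f x \<le> k})"
proof
  assume "continuous_map X dual_scott f"
  then show "\<forall>k. cocompact k \<longrightarrow> openin X {x \<in> topspace X. f x \<le> k}"
    using openin_continuous_map_preimage dual_scott_open_cocompact
    by (fastforce simp: openin_dual_scott)
next
  assume R: "\<forall>k. cocompact k \<longrightarrow> openin X {x \<in> topspace X. f x \<le> k}"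
  have "openin dual_scott (UNIV :: 's set)"
    by (auto simp: openin_dual_scott dual_scott_open_def codirected_def)
  then have "topspace dual_scott = (UNIV :: 's set)"
    using openin_subset by blast
  moreover have "openin X {x \<in> topspace X. f x \<in> U}" if "dual_scott_open U" for U
  proof (subst openin_subopen, intro ballI)
    fix x assume x: "x \<in> {x \<in> topspace X. f x \<in> U}"
    then obtain k where "cocompact k" "f x \<le> k" "{..k} \<subseteq> U"
      using dual_scott_open_cocompact_nbhd[OF \<open>dual_scott_open U\<close>] by blast
    with R x show "\<exists>T. openin X T \<and> x \<in> T \<and> T \<subseteq> {x \<in> topspace X. f x \<in> U}"
      by (intro exI[of _ "{x \<in> topspace X. f x \<le> k}"]) auto
  qed
  ultimately show "continuous_map X dual_scott f"
    by (simp add: continuous_map_def openin_dual_scott)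
qed


section \<open>Continuous functions and integration\<close>

lemma clopens_Un: "a \<in> clopens X \<Longrightarrow> b \<in> clopens X \<Longrightarrow> a \<union> b \<in> clopens X"
  by (auto simp: clopens_def)

lemma clopens_Int: "a \<in> clopens X \<Longrightarrow> b \<in> clopens X \<Longrightarrow> a \<inter> b \<in> clopens X"
  by (auto simp: clopens_def)

lemma clopens_Diff: "a \<in> clopens X \<Longrightarrow> b \<in> clopens X \<Longrightarrow> a - b \<in> clopens X"
  by (auto simp: clopens_def)

lemma clopens_empty: "{} \<in> clopens X"
  by (auto simp: clopens_def)

lemma clopens_subset: "b \<in> clopens X \<Longrightarrow> b \<subseteq> topspace X"
  by (auto simp: clopens_def openin_subset)

lemma continuous_functions_iff:
  fixes f :: "'x \<Rightarrow> 's::{idempotent_semiring, profinite_semiring}"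
  shows "f \<in> continuous_functions X \<longleftrightarrow> f \<in> extensional (topspace X) \<and>
    (\<forall>k. cocompact k \<longrightarrow> openin X {x \<in> topspace X. f x \<le> k})"
  by (simp add: continuous_functions_def continuous_map_dual_scott_iff)

lemma continuous_functions_extensional:
  "f \<in> continuous_functions X \<Longrightarrow> f \<in> extensional (topspace X)"
  by (simp add: continuous_functions_def)

lemma zero_in_continuous_functions:
  "(\<lambda>x\<in>topspace X. 0 :: 's::{idempotent_semiring, profinite_semiring}) \<in> continuous_functions X"
  by (auto simp: continuous_functions_iff cong: conj_cong)

lemma add_in_continuous_functions:
  fixes f g :: "'x \<Rightarrow> 's::{idempotent_semiring, profinite_semiring}"
  assumes "f \<in> continuous_functions X" "g \<in> continuous_functions X"
  shows "(\<lambda>x\<in>topspace X. f x + g x) \<in> continuous_functions X"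
proof -
  have "{x \<in> topspace X. (\<lambda>x\<in>topspace X. f x + g x) x \<le> k} =
      {x \<in> topspace X. f x \<le> k} \<inter> {x \<in> topspace X. g x \<le> k}" for k
    by (auto simp: add_le_iff)
  then show ?thesis
    using assms by (auto simp: continuous_functions_iff)
qed

lemma mult_in_continuous_functions:
  fixes f :: "'x \<Rightarrow> 's::{idempotent_semiring, profinite_semiring}"
  assumes "f \<in> continuous_functions X"
  shows "(\<lambda>x\<in>topspace X. s * f x) \<in> continuous_functions X"
  unfolding continuous_functions_iff
proof (intro conjI allI impI)
  fix k :: 's assume "cocompact k"
  then obtain m where m: "cocompact m" "\<And>t. s * t \<le> k \<longleftrightarrow> t \<le> m"
    using cocompact_mult_residual by blast
  \<comment> \<open>The residual \<open>m\<close> exchanges a sublevel set of the multiple for one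
    of \<open>f\<close>.\<close>
  have "{x \<in> topspace X. (\<lambda>x\<in>topspace X. s * f x) x \<le> k} = {x \<in> topspace X. f x \<le> m}"
    using m(2) by auto
  then show "openin X {x \<in> topspace X. (\<lambda>x\<in>topspace X. s * f x) x \<le> k}"
    using assms m(1) by (simp add: continuous_functions_iff)
qed auto

section \<open>Integrals as suprema\<close>

lemma integral_over_le_iff:
  fixes f :: "'x \<Rightarrow> 's::{idempotent_semiring, profinite_semiring}"
  shows "integral_over b f \<le> u \<longleftrightarrow> (\<forall>x\<in>b. f x \<le> u)"
  by (simp add: integral_over_def lub_le_iff)

lemma integral_over_cong:
  "(\<And>x. x \<in> b \<Longrightarrow> f x = g x) \<Longrightarrow> integral_over b f = integral_over b g"
  unfolding integral_over_def by (metis image_cong)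

lemma integral_over_restrict:
  "b \<in> clopens X \<Longrightarrow> integral_over b (restrict f (topspace X)) = integral_over b f"
  using clopens_subset by (fastforce intro: integral_over_cong)

lemma integral_over_empty:
  "integral_over {} (f :: 'x \<Rightarrow> 's::{idempotent_semiring, profinite_semiring}) = 0"
  using integral_over_le_iff[of "{}" f 0] by simp

lemma integral_over_zero:
  "integral_over b (\<lambda>x. 0 :: 's::{idempotent_semiring, profinite_semiring}) = 0"
  using integral_over_le_iff[of b "\<lambda>x. 0 :: 's" 0] by simp

lemma integral_over_Un:
  fixes f :: "'x \<Rightarrow> 's::{idempotent_semiring, profinite_semiring}"
  shows "integral_over (a \<union> b) f = integral_over a f + integral_over b f"
  by (rule order_antisym)
    (auto simp: integral_over_le_iff add_le_iff,
     (metis add_le_iff integral_over_le_iff order_refl UnCI)+)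

lemma integral_over_add:
  fixes f g :: "'x \<Rightarrow> 's::{idempotent_semiring, profinite_semiring}"
  shows "integral_over b (\<lambda>x. f x + g x) = integral_over b f + integral_over b g"
proof -
  have "integral_over b (\<lambda>x. f x + g x) \<le> u \<longleftrightarrow> integral_over b f + integral_over b g \<le> u" for u
    by (auto simp: integral_over_le_iff add_le_iff)
  then show ?thesis by (metis order_antisym order_refl)
qed

lemma integral_over_mult:
  fixes f :: "'x \<Rightarrow> 's::{idempotent_semiring, profinite_semiring}"
  shows "integral_over b (\<lambda>x. s * f x) = s * integral_over b f"
  using lub_mult_left[of s "f ` b"] by (simp add: integral_over_def image_image)

lemma integral_measure_in_S_measures:
  fixes f :: "'x \<Rightarrow> 's::{idempotent_semiring, profinite_semiring}"
  shows "integral_measure X f \<in> S_measures X"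
  by (auto simp: S_measures_def integral_measure_def clopens_empty clopens_Un
      integral_over_empty integral_over_Un)


section \<open>Measures and their densities\<close>

lemma S_measure_mono:
  assumes "\<mu> \<in> S_measures X" "a \<in> clopens X" "b \<in> clopens X" "a \<subseteq> b"
  shows "\<mu> a \<le> \<mu> b"
proof -
  have "\<mu> (a \<union> (b - a)) = \<mu> a + \<mu> (b - a)"
    using assms clopens_Diff unfolding S_measures_def by blast
  then show ?thesis
    using assms(4) le_add_left(1) by (metis Diff_partition)
qed

text \<open>Additivity speaks of disjoint sets, so \<open>b\<close> is first replaced by
  \<open>b - a\<close> and monotonicity restores it.\<close>

lemma S_measure_Un_le:
  assumes "\<mu> \<in> S_measures X" "a \<in> clopens X" "b \<in> clopens X"
  shows "\<mu> (a \<union> b) \<le> \<mu> a + \<mu> b"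
proof -
  have "\<mu> (a \<union> (b - a)) = \<mu> a + \<mu> (b - a)"
    using assms clopens_Diff unfolding S_measures_def by blast
  moreover have "\<mu> (b - a) \<le> \<mu> b"
    using assms clopens_Diff by (intro S_measure_mono) auto
  ultimately show ?thesis
    by (metis Un_Diff_cancel add_le_iff le_add_left order_trans)
qed

lemma S_measure_Union_le:
  assumes "\<mu> \<in> S_measures X" "finite \<F>" "\<F> \<subseteq> clopens X" "\<And>a. a \<in> \<F> \<Longrightarrow> \<mu> a \<le> k"
  shows "\<Union>\<F> \<in> clopens X \<and> \<mu> (\<Union>\<F>) \<le> k"
  using assms(2-4)
proof (induction \<F> rule: finite_induct)
  case empty
  then show ?case using assms(1) by (simp add: clopens_empty S_measures_def)
next
  case (insert a \<F>)
  then have "\<Union>\<F> \<in> clopens X" "\<mu> a + \<mu> (\<Union>\<F>) \<le> k" "a \<in> clopens X"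
    by (auto simp: add_le_iff)
  then show ?case
    using order_trans[OF S_measure_Un_le[OF assms(1)]] clopens_Un by (metis Union_insert)
qed

text \<open>Clopen neighbourhoods of \<open>x\<close> are closed under intersection and
  \<open>\<mu>\<close> is monotone, so its values on them are codirected and one of them is already
  below \<open>k\<close>.\<close>

lemma delta_le_cocompactE:
  fixes \<mu> :: "'x set \<Rightarrow> 's::{idempotent_semiring, profinite_semiring}"
  assumes "\<mu> \<in> S_measures X" "x \<in> topspace X" "cocompact k" "delta X \<mu> x \<le> k"
  obtains b where "b \<in> clopens X" "x \<in> b" "\<mu> b \<le> k"
proof -
  let ?N = "{b \<in> clopens X. x \<in> b}"
  have "topspace X \<in> ?N"
    using assms(2) by (auto simp: clopens_def)
  have "codirected (\<mu> ` ?N)"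
    unfolding codirected_def
  proof (intro conjI ballI)
    show "\<mu> ` ?N \<noteq> {}" using \<open>topspace X \<in> ?N\<close> by blast
    fix s t assume "s \<in> \<mu> ` ?N" "t \<in> \<mu> ` ?N"
    then obtain a b where "a \<in> ?N" "b \<in> ?N" "s = \<mu> a" "t = \<mu> b" by blast
    then have "a \<inter> b \<in> ?N" "\<mu> (a \<inter> b) \<le> s" "\<mu> (a \<inter> b) \<le> t"
      using S_measure_mono[OF assms(1), of "a \<inter> b"] clopens_Int[of a X b] by auto
    then show "\<exists>z\<in>\<mu> ` ?N. z \<le> s \<and> z \<le> t"
      by blast
  qed
  then show thesis
    using codirected_glb_le_cocompact[of "\<mu> ` ?N" k] assms(2-4) that by (auto simp: delta_def)
qed

lemma delta_le:
  fixes \<mu> :: "'x set \<Rightarrow> 's::{idempotent_semiring, profinite_semiring}"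
  assumes "b \<in> clopens X" "x \<in> b"
  shows "delta X \<mu> x \<le> \<mu> b"
  using assms clopens_subset[of b X] by (auto simp: delta_def intro: glb_lower)

lemma delta_in_continuous_functions:
  fixes \<mu> :: "'x set \<Rightarrow> 's::{idempotent_semiring, profinite_semiring}"
  assumes "\<mu> \<in> S_measures X"
  shows "delta X \<mu> \<in> continuous_functions X"
  unfolding continuous_functions_iff
proof (intro conjI allI impI)
  show "delta X \<mu> \<in> extensional (topspace X)" by (simp add: delta_def)
  fix k :: 's assume "cocompact k"
  show "openin X {x \<in> topspace X. delta X \<mu> x \<le> k}"
  proof (subst openin_subopen, intro ballI)
    fix x assume "x \<in> {x \<in> topspace X. delta X \<mu> x \<le> k}"
    then obtain b where b: "b \<in> clopens X" "x \<in> b" "\<mu> b \<le> k"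
      using delta_le_cocompactE[OF assms _ \<open>cocompact k\<close>] by blast
    \<comment> \<open>The same \<open>b\<close> bounds the density at each of its points.\<close>
    then have "b \<subseteq> {x \<in> topspace X. delta X \<mu> x \<le> k}"
      using order_trans[OF delta_le[OF b(1), of _ \<mu>] b(3)] clopens_subset by blast
    with b show "\<exists>T. openin X T \<and> x \<in> T \<and> T \<subseteq> {x \<in> topspace X. delta X \<mu> x \<le> k}"
      by (auto simp: clopens_def)
  qed
qed

lemma integral_over_delta:
  fixes \<mu> :: "'x set \<Rightarrow> 's::{idempotent_semiring, profinite_semiring}"
  assumes "compact_space X" "\<mu> \<in> S_measures X" "b \<in> clopens X"
  shows "integral_over b (delta X \<mu>) = \<mu> b"
proof (rule order_antisym)
  show "integral_over b (delta X \<mu>) \<le> \<mu> b"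
    using assms(3) by (auto simp: integral_over_le_iff intro: delta_le)
  show "\<mu> b \<le> integral_over b (delta X \<mu>)"
  proof (rule le_if_le_cocompact)
    fix k :: 's assume k: "cocompact k" "integral_over b (delta X \<mu>) \<le> k"
    \<comment> \<open>The clopens of measure at most \<open>k\<close> cover \<open>b\<close>. A
      finite subcover has a union whose measure is still at most \<open>k\<close>, and that union
      contains \<open>b\<close>.\<close>
    let ?\<C> = "{c \<in> clopens X. \<mu> c \<le> k}"
    have "compactin X b"
      using assms(1,3) closedin_compact_space by (auto simp: clopens_def)
    moreover have "b \<subseteq> \<Union>?\<C>"
    proof
      fix x assume "x \<in> b"
      then have "x \<in> topspace X" "delta X \<mu> x \<le> k"
        using k(2) clopens_subset[OF assms(3)] by (auto simp: integral_over_le_iff)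
      then show "x \<in> \<Union>?\<C>"
        using delta_le_cocompactE[OF assms(2) _ k(1)] by blast
    qed
    moreover have "\<forall>c\<in>?\<C>. openin X c" by (auto simp: clopens_def)
    ultimately obtain \<F> where "finite \<F>" "\<F> \<subseteq> ?\<C>" "b \<subseteq> \<Union>\<F>"
      unfolding compactin_def by meson
    then have "\<Union>\<F> \<in> clopens X" "\<mu> (\<Union>\<F>) \<le> k"
      using S_measure_Union_le[OF assms(2), of \<F> k] by auto
    then show "\<mu> b \<le> k"
      using S_measure_mono[OF assms(2,3) _ \<open>b \<subseteq> \<Union>\<F>\<close>] order_trans by blast
  qed
qed

lemma integral_measure_delta:
  fixes \<mu> :: "'x set \<Rightarrow> 's::{idempotent_semiring, profinite_semiring}"
  assumes "compact_space X" "\<mu> \<in> S_measures X"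
  shows "integral_measure X (delta X \<mu>) = \<mu>"
proof (rule extensionalityI)
  show "integral_measure X (delta X \<mu>) \<in> extensional (clopens X)"
    by (simp add: integral_measure_def)
  show "\<mu> \<in> extensional (clopens X)"
    using assms(2) by (simp add: S_measures_def)
qed (simp add: integral_measure_def integral_over_delta[OF assms])

lemma delta_integral_measure:
  fixes f :: "'x \<Rightarrow> 's::{idempotent_semiring, profinite_semiring}"
  assumes "boolean_space X" "f \<in> continuous_functions X"
  shows "delta X (integral_measure X f) = f"
proof (rule extensionalityI)
  show "delta X (integral_measure X f) \<in> extensional (topspace X)"
    by (simp add: delta_def)
  show "f \<in> extensional (topspace X)"
    using assms(2) by (simp add: continuous_functions_def)
  fix x assume x: "x \<in> topspace X"
  show "delta X (integral_measure X f) x = f x"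
  proof (rule order_antisym)
    show "f x \<le> delta X (integral_measure X f) x"
      using x integral_over_le_iff[of _ f] by (auto simp: delta_def le_glb_iff integral_measure_def)
    show "delta X (integral_measure X f) x \<le> f x"
    proof (rule le_if_le_cocompact)
      fix k :: 's assume "cocompact k" "f x \<le> k"
      \<comment> \<open>By continuity the sublevel set is an open neighbourhood of \<open>x\<close>;
        a clopen \<open>b\<close> inside it has integral at most \<open>k\<close>.\<close>
      then obtain b where b: "b \<in> clopens X" "x \<in> b" "b \<subseteq> {x \<in> topspace X. f x \<le> k}"
        using boolean_space_clopen_nbhd[OF assms(1), of "{x \<in> topspace X. f x \<le> k}" x] assms(2) x
        by (auto simp: continuous_functions_iff)
      then have "integral_measure X f b \<le> k"
        by (auto simp: integral_measure_def integral_over_le_iff)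
      then show "delta X (integral_measure X f) x \<le> k"
        using delta_le[OF b(1,2)] by (rule order_trans[rotated])
    qed
  qed
qed


section \<open>The isomorphism of topological semimodules\<close>

lemma semimodule_measure_semimodule:
  "semimodule (measure_semimodule X :: ('s::{idempotent_semiring, profinite_semiring}, 'x set \<Rightarrow> 's) semimodule_top)"
  unfolding semimodule_def mcarrier_measure_semimodule
  by (auto simp: measure_semimodule_def S_measures_def clopens_empty clopens_Un extensional_def
      algebra_simps fun_eq_iff)

lemma semimodule_function_semimodule:
  "semimodule (function_semimodule X :: ('s::{idempotent_semiring, profinite_semiring}, 'x \<Rightarrow> 's) semimodule_top)"
  unfolding semimodule_def mcarrier_function_semimodule
  by (auto simp: function_semimodule_def zero_in_continuous_functions add_in_continuous_functions
      mult_in_continuous_functions algebra_simps fun_eq_iff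
      dest: continuous_functions_extensional[THEN extensional_arb])

text \<open>Continuity into the product is checked at each clopen \<open>b\<close>, where the
  preimages of open sets are the generating sets of the function topology. The algebraic laws are
  those of integrals.\<close>

lemma continuous_semimodule_hom_integral_measure:
  "continuous_semimodule_hom
     (function_semimodule X :: ('s::{idempotent_semiring, profinite_semiring}, 'x \<Rightarrow> 's) semimodule_top)
     (measure_semimodule X) (integral_measure X)"
  unfolding continuous_semimodule_hom_def mcarrier_function_semimodule
proof (intro conjI ballI allI semimodule_function_semimodule semimodule_measure_semimodule)
  let ?C = "function_semimodule X :: ('s, 'x \<Rightarrow> 's) semimodule_top"
  have "continuous_map (mtop ?C) euclidean (\<lambda>f. integral_measure X f b)" if "b \<in> clopens X" for b
    unfolding continuous_map_def mcarrier_function_semimodule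
  proof (intro conjI allI impI)
    fix U :: "'s set" assume "openin euclidean U"
    then have "openin (mtop ?C) {f \<in> continuous_functions X. integral_over b f \<in> U}"
      using that by (auto simp: function_semimodule_def intro!: topology_generated_by_Basis)
    then show "openin (mtop ?C) {f \<in> continuous_functions X. integral_measure X f b \<in> U}"
      using that by (simp add: integral_measure_def)
  qed auto
  then show "continuous_map (mtop ?C) (mtop (measure_semimodule X)) (integral_measure X)"
    using integral_measure_in_S_measures
    by (auto simp: measure_semimodule_def continuous_map_in_subtopology continuous_map_componentwise
        integral_measure_def)
qed (auto simp: function_semimodule_def measure_semimodule_def integral_measure_def fun_eq_iff
    integral_over_restrict integral_over_zero integral_over_add integral_over_mult)

text \<open>Since integrating the density returns \<open>\<mu>\<close>, the preimage of a generating
  set is a preimage under evaluation at \<open>b\<close>, a continuous projection.\<close>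

lemma continuous_map_delta:
  assumes "compact_space X"
  shows "continuous_map
     (mtop (measure_semimodule X :: ('s::{idempotent_semiring, profinite_semiring}, 'x set \<Rightarrow> 's) semimodule_top))
     (mtop (function_semimodule X)) (delta X)"
proof -
  let ?M = "measure_semimodule X :: ('s, 'x set \<Rightarrow> 's) semimodule_top"
  let ?\<S> = "{{f \<in> continuous_functions X. integral_over b f \<in> U} | b (U :: 's set). b \<in> clopens X \<and> open U}"
  have "continuous_map (mtop ?M) (topology_generated_by ?\<S>) (delta X)"
  proof (rule continuous_on_generated_topo)
    fix W assume "W \<in> ?\<S>"
    then obtain b U where W: "W = {f \<in> continuous_functions X. integral_over b f \<in> U}"
      and b: "b \<in> clopens X" and U: "open U" by blast
    have "delta X -` W \<inter> topspace (mtop ?M) = {\<mu> \<in> topspace (mtop ?M). \<mu> b \<in> U}"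
      using assms b delta_in_continuous_functions
      by (auto simp: W mcarrier_measure_semimodule integral_over_delta)
    moreover have "continuous_map (mtop ?M) euclidean (\<lambda>\<mu>. \<mu> b)"
      using b by (auto simp: measure_semimodule_def intro!: continuous_map_from_subtopology
          continuous_map_product_projection)
    ultimately show "openin (mtop ?M) (delta X -` W \<inter> topspace (mtop ?M))"
      using U openin_continuous_map_preimage by fastforce
  next
    have "\<Union>?\<S> = continuous_functions X"
      using mcarrier_function_semimodule[of X] by (simp add: function_semimodule_def)
    then show "delta X ` topspace (mtop ?M) \<subseteq> \<Union>?\<S>"
      using delta_in_continuous_functions by (auto simp: mcarrier_measure_semimodule)
  qed
  then show ?thesis by (simp add: function_semimodule_def)
qed

text \<open>Preservation of the operations passes to the inverse of a bijective homomorphism, which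
  spares a direct verification for \<open>delta\<close>.\<close>

lemma continuous_semimodule_hom_inverse:
  assumes "continuous_semimodule_hom N M k" "continuous_map (mtop M) (mtop N) h"
    and "\<And>x. x \<in> mcarrier M \<Longrightarrow> k (h x) = x" "\<And>y. y \<in> mcarrier N \<Longrightarrow> h (k y) = y"
  shows "continuous_semimodule_hom M N h"
proof -
  have h: "h x \<in> mcarrier N" if "x \<in> mcarrier M" for x
    using assms(2) that by (auto simp: continuous_map_def)
  have N: "semimodule N" and M: "semimodule M" and "k (mzero N) = mzero M"
    and kadd: "\<And>x y. x \<in> mcarrier N \<Longrightarrow> y \<in> mcarrier N \<Longrightarrow> k (madd N x y) = madd M (k x) (k y)"
    and kmult: "\<And>s x. x \<in> mcarrier N \<Longrightarrow> k (msmult N s x) = msmult M s (k x)"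
    using assms(1) unfolding continuous_semimodule_hom_def by blast+
  have carr: "mzero N \<in> mcarrier N"
    "\<And>x y. x \<in> mcarrier N \<Longrightarrow> y \<in> mcarrier N \<Longrightarrow> madd N x y \<in> mcarrier N"
    "\<And>s x. x \<in> mcarrier N \<Longrightarrow> msmult N s x \<in> mcarrier N"
    using N unfolding semimodule_def by simp_all
  show ?thesis
    unfolding continuous_semimodule_hom_def
  proof (intro conjI ballI allI M N assms(2))
    show "h (mzero M) = mzero N"
      using assms(4)[OF carr(1)] \<open>k (mzero N) = mzero M\<close> by simp
    show "h (madd M x y) = madd N (h x) (h y)" if "x \<in> mcarrier M" "y \<in> mcarrier M" for x y
      using assms(4)[OF carr(2)[OF h h]] kadd[OF h h] assms(3) that by metis
    show "h (msmult M s x) = msmult N s (h x)" if "x \<in> mcarrier M" for s x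
      using assms(4)[OF carr(3)[OF h]] kmult[OF h] assms(3) that by metis
  qed
qed

theorem theorem5p8:
  fixes X :: "'x topology"
  assumes "boolean_space X"
  shows
    "continuous_semimodule_hom
       (measure_semimodule X :: ('s::{idempotent_semiring, profinite_semiring}, 'x set \<Rightarrow> 's) semimodule_top)
       (function_semimodule X :: ('s, 'x \<Rightarrow> 's) semimodule_top)
       (delta X) \<and>
     continuous_semimodule_hom
       (function_semimodule X :: ('s, 'x \<Rightarrow> 's) semimodule_top)
       (measure_semimodule X :: ('s, 'x set \<Rightarrow> 's) semimodule_top)
       (integral_measure X) \<and>
     (\<forall>\<mu> \<in> S_measures X. integral_measure X (delta X \<mu> :: 'x \<Rightarrow> 's) = \<mu>) \<and>
     (\<forall>f \<in> continuous_functions X. delta X (integral_measure X f :: 'x set \<Rightarrow> 's) = f) \<and>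
     isomorphic_semimodules
       (measure_semimodule X :: ('s, 'x set \<Rightarrow> 's) semimodule_top)
       (function_semimodule X :: ('s, 'x \<Rightarrow> 's) semimodule_top)"
proof -
  let ?M = "measure_semimodule X :: ('s, 'x set \<Rightarrow> 's) semimodule_top"
  let ?C = "function_semimodule X :: ('s, 'x \<Rightarrow> 's) semimodule_top"
  have "compact_space X"
    using assms by (simp add: boolean_space_def)
  then have inv1: "\<forall>\<mu>\<in>S_measures X. integral_measure X (delta X \<mu> :: 'x \<Rightarrow> 's) = \<mu>"
    using integral_measure_delta by blast
  have inv2: "\<forall>f\<in>continuous_functions X. delta X (integral_measure X f :: 'x set \<Rightarrow> 's) = f"
    using delta_integral_measure[OF assms] by blast
  have integral: "continuous_semimodule_hom ?C ?M (integral_measure X)"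
    by (rule continuous_semimodule_hom_integral_measure)
  then have delta: "continuous_semimodule_hom ?M ?C (delta X)"
    using continuous_map_delta[OF \<open>compact_space X\<close>]
    by (rule continuous_semimodule_hom_inverse)
       (use inv1 inv2 in \<open>simp_all add: mcarrier_measure_semimodule mcarrier_function_semimodule\<close>)
  have "isomorphic_semimodules ?M ?C"
    unfolding isomorphic_semimodules_def mcarrier_measure_semimodule mcarrier_function_semimodule
    using integral delta inv1 inv2 by blast
  with integral delta inv1 inv2 show ?thesis by blast
qed

end
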